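(* Assume $K(x,y)>0$, $\mu(x)>0$, $\nu(y)>0$ for all $x,y\in S$. Let $g_0\in\mathcal H$ and $\mathcal C_{g_0}=\{g\in\mathcal H:\mathcal J(g)\le\mathcal J(g_0)\}$. Let $g_t$, $t\ge0$, be the solution of $$\dot g_t=-\log\frac{m_{g_t}}{\nu}+\mathbb E_\nu\!\left[\log\frac{m_{g_t}}{\nu}\right]\mathbf 1,\qquad g_{t=0}=g_0,$$ and set $m_t=m_{g_t}$. There exist constants $\lambda_{g_0}>0$ and $C_{g_0}>0$ such that, for all $g\in\mathcal C_{g_0}$, $$\langle f,\mathsf K_g f\rangle\ge\lambda_{g_0}\|f\|_{L^2(\nu)}^2\quad\text{for all } f:S\to\mathbb R \text{ with } \mathbb E_\nu[f]=0,$$ $$\operatorname{KL}(m_g\,\|\,\nu)\le C_{g_0}\left\|\log\frac{m_g}{\nu}-\mathbb E_\nu\!\left[\log\frac{m_g}{\nu}\right]\right\|_{L^2(\nu)}^2,$$ and for any such constants, with $\omega_{g_0}=\lambda_{g_0}/C_{g_0}$, $$\operatorname{KL}(m_t\|\nu)\le\operatorname{KL}(m_0\|\nu)\exp(-\omega_{g_0}t),\qquad t\ge0.$$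
   Context: Let $N\ge1$ be an integer and $S=\{1,\dots,N\}$. Let $Q\in\mathbb R^{N\times N}$ be the generator of a continuous-time Markov chain on $S$ (nonnegative off-diagonal entries, rows summing to zero) and $K=e^{Q}$. Let $\mu,\nu$ be probability distributions on $S$. Functions on $S$ are identified with vectors in $\mathbb R^S$; $\langle\cdot,\cdot\rangle$ is the standard Euclidean inner product on $\mathbb R^S$; $\mathbf 1$ is the constant function $1$ (in $L^2(\nu)$ expressions, a number is identified with the corresponding constant function); $\mathbb E_\nu[f]=\sum_{y\in S}\nu(y)f(y)$; $\|f\|_{L^2(\nu)}^2=\sum_{y\in S}\nu(y)f(y)^2$; $\log\frac{m}{\nu}$ is the function $y\mapsto\log(m(y)/\nu(y))$; $\operatorname{KL}(p\|q)=\sum_y p(y)\log\frac{p(y)}{q(y)}$. For $g\in\mathbb R^S$ set $Z_g(x)=\sum_{z\in S}K(x,z)e^{g(z)}$, $p_g(y|x)=\frac{K(x,y)e^{g(y)}}{Z_g(x)}$, $m_g(y)=\sum_{x\in S}\mu(x)p_g(y|x)$ (strictly positive), and $$\mathcal J(g)=\sum_{x\in S}\mu(x)\log Z_g(x)-\mathbb E_\nu[g].$$ The gauge-fixed space is $\mathcal H=\{g\in\mathbb R^S:\mathbb E_\nu[g]=0\}$. For every $g_0\in\mathcal H$ the ODE $\dot g_t=-\log\frac{m_{g_t}}{\nu}+\mathbb E_\nu\!\left[\log\frac{m_{g_t}}{\nu}\right]\mathbf 1$ with initial condition $g_{t=0}=g_0$ has a unique global solution, which stays in $\mathcal H$. The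 operator $\mathsf K_g:\mathbb R^S\to\mathbb R^S$ is $$\mathsf K_g=\sum_{x\in S}\mu(x)\left[\operatorname{Diag}(p_g(\cdot|x))-p_g(\cdot|x)p_g(\cdot|x)^\top\right].$$ *)

theory Defs
  imports "HOL-Analysis.Analysis"
begin

text \<open>
  The state space \<open>S = {1,\<dots>,N}\<close> is the universe of a finite type \<open>'n\<close>, a function on \<open>S\<close> is a vector
  of type \<open>real ^ 'n\<close>, and \<open>K(x,y)\<close> is \<open>K $ x $ y\<close>.
\<close>

definition generator :: "real^'n^'n \<Rightarrow> bool" where
  "generator Q \<longleftrightarrow>
     (\<forall>x y. x \<noteq> y \<longrightarrow> 0 \<le> Q $ x $ y) \<and> (\<forall>x. (\<Sum>y\<in>UNIV. Q $ x $ y) = 0)"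

definition prob_vector :: "real^'n \<Rightarrow> bool" where
  "prob_vector p \<longleftrightarrow> (\<forall>x. 0 \<le> p $ x) \<and> (\<Sum>x\<in>UNIV. p $ x) = 1"

primrec matpow :: "real^'n^'n \<Rightarrow> nat \<Rightarrow> real^'n^'n" where
  "matpow A 0 = mat 1"
| "matpow A (Suc k) = A ** matpow A k"

text \<open>
  The multiplication \<open>*\<close> on \<open>real^'n^'n\<close> is componentwise, so the matrix exponential is not an
  instance of the library's \<open>exp\<close>.
\<close>

definition matexp :: "real^'n^'n \<Rightarrow> real^'n^'n" where
  "matexp A = (\<Sum>k. (1 / fact k) *\<^sub>R matpow A k)"

lemma matpow_entry_bound:
  fixes A :: "real^'n^'n"
  shows "\<bar>matpow A k $ i $ j\<bar> \<le> (\<Sum>i\<in>UNIV. \<Sum>j\<in>UNIV. \<bar>A $ i $ j\<bar>) ^ k"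
proof (induction k arbitrary: i j)
  case 0
  show ?case by (simp add: mat_def)
next
  case (Suc k)
  define M where "M = (\<Sum>i\<in>UNIV. \<Sum>j\<in>UNIV. \<bar>A $ i $ j\<bar>)"
  have M0: "0 \<le> M" unfolding M_def by (intro sum_nonneg) auto
  have row: "(\<Sum>l\<in>UNIV. \<bar>A $ i $ l\<bar>) \<le> M"
    unfolding M_def by (rule member_le_sum) (auto intro: sum_nonneg)
  have "\<bar>matpow A (Suc k) $ i $ j\<bar> \<le> (\<Sum>l\<in>UNIV. \<bar>A $ i $ l * matpow A k $ l $ j\<bar>)"
    by (simp add: matrix_matrix_mult_def)
  also have "\<dots> \<le> (\<Sum>l\<in>UNIV. \<bar>A $ i $ l\<bar> * M ^ k)"
    using Suc.IH by (intro sum_mono) (auto simp: abs_mult M_def intro!: mult_left_mono)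
  also have "\<dots> = (\<Sum>l\<in>UNIV. \<bar>A $ i $ l\<bar>) * M ^ k"
    by (simp add: sum_distrib_right)
  also have "\<dots> \<le> M * M ^ k"
    using row M0 by (intro mult_right_mono) auto
  finally show ?case by (simp add: M_def)
qed

lemma matexp_summable:
  fixes A :: "real^'n^'n"
  shows "summable (\<lambda>k. (1 / fact k) *\<^sub>R matpow A k)"
proof (rule summable_comparison_test')
  define M where "M = (\<Sum>i\<in>UNIV. \<Sum>j\<in>UNIV. \<bar>A $ i $ j\<bar>)"
  define c where "c = real CARD('n) * real CARD('n)"
  show "summable (\<lambda>k. c * (inverse (fact k) * M ^ k))"
    by (intro summable_mult summable_exp)
  fix k :: nat
  have "norm (matpow A k) \<le> (\<Sum>i\<in>UNIV. norm (matpow A k $ i))"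
    unfolding norm_vec_def by (rule L2_set_le_sum) auto
  also have "\<dots> \<le> (\<Sum>i\<in>(UNIV::'n set). \<Sum>j\<in>(UNIV::'n set). M ^ k)"
  proof (rule sum_mono)
    fix i :: 'n
    have "norm (matpow A k $ i) \<le> (\<Sum>j\<in>UNIV. \<bar>matpow A k $ i $ j\<bar>)"
      by (rule norm_le_l1_cart)
    also have "\<dots> \<le> (\<Sum>j\<in>(UNIV::'n set). M ^ k)"
      unfolding M_def by (intro sum_mono matpow_entry_bound)
    finally show "norm (matpow A k $ i) \<le> (\<Sum>j\<in>(UNIV::'n set). M ^ k)" .
  qed
  also have "\<dots> = c * M ^ k" by (simp add: c_def)
  finally have "norm (matpow A k) \<le> c * M ^ k" .
  then show "norm ((1 / fact k) *\<^sub>R matpow A k) \<le> c * (inverse (fact k) * M ^ k)"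
    by (simp add: field_simps)
qed

definition expect :: "real^'n \<Rightarrow> real^'n \<Rightarrow> real" where
  "expect \<nu> f = (\<Sum>y\<in>UNIV. \<nu> $ y * f $ y)"

definition L2_norm :: "real^'n \<Rightarrow> real^'n \<Rightarrow> real" where
  "L2_norm \<nu> f = sqrt (\<Sum>y\<in>UNIV. \<nu> $ y * (f $ y)\<^sup>2)"

definition log_ratio :: "real^'n \<Rightarrow> real^'n \<Rightarrow> real^'n" where
  "log_ratio m \<nu> = (\<chi> y. ln (m $ y / \<nu> $ y))"

definition KL :: "real^'n \<Rightarrow> real^'n \<Rightarrow> real" where
  "KL p q = (\<Sum>y\<in>UNIV. p $ y * ln (p $ y / q $ y))"

definition partition_fn :: "real^'n^'n \<Rightarrow> real^'n \<Rightarrow> 'n \<Rightarrow> real" where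
  "partition_fn K g x = (\<Sum>z\<in>UNIV. K $ x $ z * exp (g $ z))"

definition tilted :: "real^'n^'n \<Rightarrow> real^'n \<Rightarrow> 'n \<Rightarrow> real^'n" where
  "tilted K g x = (\<chi> y. K $ x $ y * exp (g $ y) / partition_fn K g x)"

definition marginal :: "real^'n^'n \<Rightarrow> real^'n \<Rightarrow> real^'n \<Rightarrow> real^'n" where
  "marginal K \<mu> g = (\<chi> y. \<Sum>x\<in>UNIV. \<mu> $ x * tilted K g x $ y)"

definition dual_functional :: "real^'n^'n \<Rightarrow> real^'n \<Rightarrow> real^'n \<Rightarrow> real^'n \<Rightarrow> real" where
  "dual_functional K \<mu> \<nu> g = (\<Sum>x\<in>UNIV. \<mu> $ x * ln (partition_fn K g x)) - expect \<nu> g"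

definition gauge_space :: "real^'n \<Rightarrow> (real^'n) set" where
  "gauge_space \<nu> = {g. expect \<nu> g = 0}"

definition sublevel :: "real^'n^'n \<Rightarrow> real^'n \<Rightarrow> real^'n \<Rightarrow> real^'n \<Rightarrow> (real^'n) set" where
  "sublevel K \<mu> \<nu> g0 =
     {g \<in> gauge_space \<nu>. dual_functional K \<mu> \<nu> g \<le> dual_functional K \<mu> \<nu> g0}"

definition diag :: "real^'n \<Rightarrow> real^'n^'n" where
  "diag v = (\<chi> i j. if i = j then v $ i else 0)"

definition cov_operator :: "real^'n^'n \<Rightarrow> real^'n \<Rightarrow> real^'n \<Rightarrow> real^'n^'n" where
  "cov_operator K \<mu> g = (\<Sum>x\<in>UNIV. \<mu> $ x *\<^sub>R
     (diag (tilted K g x) -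
      (columnvector (tilted K g x) :: real^1^'n) ** (rowvector (tilted K g x) :: real^'n^1)))"

text \<open>\<open>vec c\<close> is the constant function \<open>c\<close> on the state space.\<close>

definition flow_field :: "real^'n^'n \<Rightarrow> real^'n \<Rightarrow> real^'n \<Rightarrow> real^'n \<Rightarrow> real^'n" where
  "flow_field K \<mu> \<nu> g =
     - log_ratio (marginal K \<mu> g) \<nu> + vec (expect \<nu> (log_ratio (marginal K \<mu> g) \<nu>))"

definition flow_solution ::
    "real^'n^'n \<Rightarrow> real^'n \<Rightarrow> real^'n \<Rightarrow> real^'n \<Rightarrow> (real \<Rightarrow> real^'n) \<Rightarrow> bool" where
  "flow_solution K \<mu> \<nu> g0 g \<longleftrightarrow> g 0 = g0 \<and>
     (\<forall>t\<ge>0. (g has_vector_derivative flow_field K \<mu> \<nu> (g t)) (at t within {0..}))"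

definition admissible_constants ::
    "real^'n^'n \<Rightarrow> real^'n \<Rightarrow> real^'n \<Rightarrow> real^'n \<Rightarrow> real \<Rightarrow> real \<Rightarrow> bool" where
  "admissible_constants K \<mu> \<nu> g0 lam C \<longleftrightarrow> lam > 0 \<and> C > 0 \<and>
     (\<forall>g\<in>sublevel K \<mu> \<nu> g0.
        (\<forall>f. expect \<nu> f = 0 \<longrightarrow> f \<bullet> (cov_operator K \<mu> g *v f) \<ge> lam * (L2_norm \<nu> f)\<^sup>2) \<and>
        KL (marginal K \<mu> g) \<nu> \<le> C * (L2_norm \<nu>
          (log_ratio (marginal K \<mu> g) \<nu> - vec (expect \<nu> (log_ratio (marginal K \<mu> g) \<nu>))))\<^sup>2)"

end

theory Submission
  imports Defs
begin

text \<open>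
  The flow is a nonlinearly preconditioned gradient descent for \<open>\<J>\<close>, and the decay rate comes from
  differentiating \<open>KL(m\<^sub>t \<parallel> \<nu>)\<close> along it.  The Jacobian of \<open>g \<mapsto> m\<^sub>g\<close> is the covariance operator
  \<open>\<K>\<^sub>g\<close> (lemma \<open>marginal_derivative\<close>), whose values have total mass zero.
  Writing \<open>h = ln (m\<^sub>g / \<nu>)\<close> and \<open>w = E\<^sub>\<nu>[h] - h\<close> for the velocity of the flow,
  \<open>d/dt KL = \<langle>\<K>\<^sub>g w, h\<rangle> = - \<langle>w, \<K>\<^sub>g w\<rangle>\<close>, because the image of \<open>\<K>\<^sub>g\<close> is orthogonal to
  constants.  The two inequalities that define admissible constants bound this by \<open>- (\<lambda> / C) KL\<close>, and Gronwall's argument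
  finishes.  Those inequalities are available at time \<open>t\<close> because the flow never leaves the
  sublevel set: \<open>E\<^sub>\<nu>[g]\<close> is conserved, and \<open>d/dt \<J> = \<langle>m\<^sub>g - \<nu>, w\<rangle> = - \<langle>m\<^sub>g - \<nu>, h\<rangle> \<le> 0\<close>,
  since \<open>m - \<nu>\<close> and \<open>ln (m / \<nu>)\<close> have the same sign pointwise.

  Admissible constants can be given explicitly.  On the sublevel set, \<open>\<J>\<close> controls the maximum of
  \<open>g\<close> and the gauge then controls its minimum, so all the probabilities \<open>p\<^sub>g(y|x)\<close> are
  at least some \<open>\<delta> > 0\<close> (lemma \<open>tilted_lower_bound_on_sublevel\<close>).  As \<open>\<langle>f, \<K>\<^sub>g f\<rangle>\<close> is
  an average of variances of \<open>f\<close> under the \<open>p\<^sub>g(\<cdot>|x)\<close>, comparison with \<open>\<nu> \<le> 1\<close> shows that \<open>\<lambda> = \<delta>\<close>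
  works.  The second inequality holds with \<open>C = \<Sum>\<^sub>y 1 / \<nu>(y)\<close> for any two positive
  probability vectors (lemma \<open>KL_le_log_ratio_fluctuation\<close>).
\<close>

section \<open>Entropy inequalities for positive probability vectors\<close>

lemma prob_vector_le_1:
  assumes "prob_vector p"
  shows "p $ x \<le> 1"
proof -
  have "p $ x \<le> (\<Sum>x\<in>UNIV. p $ x)"
    using assms by (intro member_le_sum) (auto simp: prob_vector_def)
  then show ?thesis using assms by (simp add: prob_vector_def)
qed

lemma expect_minus_vec:
  assumes "prob_vector \<nu>"
  shows "expect \<nu> (f - vec c) = expect \<nu> f - c"
proof -
  have "expect \<nu> (f - vec c) = (\<Sum>y\<in>UNIV. \<nu> $ y * f $ y) - (\<Sum>y\<in>UNIV. \<nu> $ y) * c"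
    by (simp add: expect_def algebra_simps sum_subtractf sum_distrib_left)
  then show ?thesis using assms by (simp add: expect_def prob_vector_def)
qed

lemma L2_norm_power2:
  assumes "prob_vector \<nu>"
  shows "(L2_norm \<nu> f)\<^sup>2 = (\<Sum>y\<in>UNIV. \<nu> $ y * (f $ y)\<^sup>2)"
  using assms by (simp add: L2_norm_def prob_vector_def sum_nonneg)

text \<open>The difference of the two sides is the symmetrised relative entropy.\<close>

lemma expect_log_ratio_le_KL:
  assumes "\<And>y. m $ y > 0" and "\<And>y. \<nu> $ y > 0"
  shows "expect \<nu> (log_ratio m \<nu>) \<le> KL m \<nu>"
proof -
  have "0 \<le> (m $ y - \<nu> $ y) * ln (m $ y / \<nu> $ y)" for y
  proof (cases "\<nu> $ y \<le> m $ y")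
    case True
    then show ?thesis using assms(2)[of y] by (intro mult_nonneg_nonneg ln_ge_zero) auto
  next
    case False
    then show ?thesis using assms(1)[of y] assms(2)[of y]
      by (intro mult_nonpos_nonpos) (auto simp: ln_le_zero_iff)
  qed
  then have "0 \<le> (\<Sum>y\<in>UNIV. (m $ y - \<nu> $ y) * ln (m $ y / \<nu> $ y))"
    by (intro sum_nonneg) auto
  also have "\<dots> = KL m \<nu> - expect \<nu> (log_ratio m \<nu>)"
    by (simp add: KL_def expect_def log_ratio_def algebra_simps sum_subtractf)
  finally show ?thesis by simp
qed

text \<open>This is Jensen's inequality, through \<open>ln r \<le> r - 1\<close>.\<close>

lemma expect_log_ratio_nonpos:
  assumes "prob_vector m" "prob_vector \<nu>" "\<And>y. m $ y > 0" "\<And>y. \<nu> $ y > 0"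
  shows "expect \<nu> (log_ratio m \<nu>) \<le> 0"
proof -
  have "expect \<nu> (log_ratio m \<nu>) \<le> (\<Sum>y\<in>UNIV. \<nu> $ y * (m $ y / \<nu> $ y - 1))"
    unfolding expect_def log_ratio_def using assms(3,4)
    by (auto intro!: sum_mono mult_left_mono ln_le_minus_one simp: less_imp_le)
  also have "\<dots> = (\<Sum>y\<in>UNIV. m $ y - \<nu> $ y)"
    using assms(4) by (intro sum.cong) (auto simp: field_simps less_imp_neq[symmetric])
  finally show ?thesis using assms(1,2) by (simp add: sum_subtractf prob_vector_def)
qed

lemma exp_difference_times_difference_le:
  fixes a h B :: real
  assumes "exp h \<le> B" "exp a \<le> B"
  shows "(exp h - exp a) * (h - a) \<le> B * (h - a)\<^sup>2"
proof -
  have *: "(exp s - exp r) * (s - r) \<le> B * (s - r)\<^sup>2" if "r \<le> s" "exp s \<le> B" for r s :: real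
  proof -
    have "1 - (s - r) \<le> exp (r - s)" using exp_ge_add_one_self[of "r - s"] by linarith
    then have "exp s * (1 - exp (r - s)) \<le> exp s * (s - r)" by (intro mult_left_mono) auto
    also have "\<dots> \<le> B * (s - r)" using that by (intro mult_right_mono) auto
    finally have "exp s - exp r \<le> B * (s - r)" by (simp add: exp_diff algebra_simps)
    then have "(exp s - exp r) * (s - r) \<le> B * (s - r) * (s - r)"
      using that by (intro mult_right_mono) auto
    then show ?thesis by (simp add: power2_eq_square mult.assoc)
  qed
  show ?thesis
  proof (cases "a \<le> h")
    case True
    then show ?thesis using * assms by simp
  next
    case False
    then have "(exp a - exp h) * (a - h) \<le> B * (a - h)\<^sup>2" using * assms by simp
    then show ?thesis by (simp add: algebra_simps power2_eq_square)
  qed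
qed

text \<open>
  Let \<open>h = ln (m / \<nu>)\<close> have mean \<open>a\<close> and fluctuation \<open>u = h - a\<close>.  As \<open>a \<le> 0\<close>, the entropy
  \<open>\<langle>m, u\<rangle> + a\<close> is at most \<open>\<langle>m, u\<rangle>\<close>.  As \<open>u\<close> is centred, this equals
  \<open>\<langle>m - e\<^sup>a \<nu>, u\<rangle> = E\<^sub>\<nu>[(e\<^sup>h - e\<^sup>a) (h - a)]\<close>, which is quadratic in the fluctuation because
  \<open>e\<^sup>h = m / \<nu>\<close> and \<open>e\<^sup>a\<close> are bounded.
\<close>

lemma KL_le_log_ratio_fluctuation:
  fixes m \<nu> :: "real^'n"
  assumes m: "prob_vector m" and \<nu>: "prob_vector \<nu>"
    and m_pos: "\<And>y. m $ y > 0" and \<nu>_pos: "\<And>y. \<nu> $ y > 0"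
  shows "KL m \<nu> \<le> (\<Sum>y\<in>UNIV. 1 / \<nu> $ y) *
    (L2_norm \<nu> (log_ratio m \<nu> - vec (expect \<nu> (log_ratio m \<nu>))))\<^sup>2"
proof -
  define h a C where "h = log_ratio m \<nu>" and "a = expect \<nu> h" and "C = (\<Sum>y\<in>UNIV. 1 / \<nu> $ y)"
  have exp_h: "exp (h $ y) = m $ y / \<nu> $ y" for y
    using m_pos[of y] \<nu>_pos[of y] by (simp add: h_def log_ratio_def)
  have a: "a \<le> 0"
    unfolding a_def h_def by (intro expect_log_ratio_nonpos assms)
  have inv_le: "1 / \<nu> $ y \<le> C" for y
    unfolding C_def using \<nu>_pos by (intro member_le_sum) (auto simp: less_imp_le)
  have exp_h_le: "exp (h $ y) \<le> C" for y
  proof -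
    have "m $ y / \<nu> $ y \<le> 1 / \<nu> $ y"
      using prob_vector_le_1[OF m] \<nu>_pos[of y] by (intro divide_right_mono) (auto simp: less_imp_le)
    then show ?thesis using inv_le[of y] by (simp add: exp_h)
  qed
  have exp_a_le: "exp a \<le> C"
  proof -
    fix y :: 'n
    have "1 \<le> 1 / \<nu> $ y" using prob_vector_le_1[OF \<nu>] \<nu>_pos by simp
    moreover have "exp a \<le> 1" using a by simp
    ultimately show ?thesis using inv_le[of y] by linarith
  qed
  have centred: "(\<Sum>y\<in>UNIV. \<nu> $ y * (h $ y - a)) = 0"
  proof -
    have "(\<Sum>y\<in>UNIV. \<nu> $ y * (h $ y - a)) = expect \<nu> (h - vec a)" by (simp add: expect_def)
    then show ?thesis by (simp add: expect_minus_vec[OF \<nu>] a_def)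
  qed
  have "KL m \<nu> = (\<Sum>y\<in>UNIV. m $ y * h $ y)"
    by (simp add: KL_def h_def log_ratio_def)
  also have "\<dots> = (\<Sum>y\<in>UNIV. m $ y * (h $ y - a)) + a"
    using m by (simp add: algebra_simps sum_subtractf sum_distrib_left[symmetric] prob_vector_def)
  also have "\<dots> \<le> (\<Sum>y\<in>UNIV. m $ y * (h $ y - a)) - exp a * (\<Sum>y\<in>UNIV. \<nu> $ y * (h $ y - a))"
    using a centred by simp
  also have "\<dots> = (\<Sum>y\<in>UNIV. \<nu> $ y * ((exp (h $ y) - exp a) * (h $ y - a)))"
    unfolding sum_distrib_left sum_subtractf[symmetric]
  proof (rule sum.cong)
    fix y
    have "m $ y = \<nu> $ y * exp (h $ y)" using \<nu>_pos[of y] by (simp add: exp_h)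
    then show "m $ y * (h $ y - a) - exp a * (\<nu> $ y * (h $ y - a)) =
      \<nu> $ y * ((exp (h $ y) - exp a) * (h $ y - a))"
      by (simp add: algebra_simps)
  qed simp
  also have "\<dots> \<le> (\<Sum>y\<in>UNIV. \<nu> $ y * (C * (h $ y - a)\<^sup>2))"
    using \<nu>_pos exp_h_le exp_a_le
    by (intro sum_mono mult_left_mono exp_difference_times_difference_le) (auto simp: less_imp_le)
  also have "\<dots> = C * (L2_norm \<nu> (h - vec a))\<^sup>2"
    by (simp add: L2_norm_power2[OF \<nu>] sum_distrib_left mult_ac)
  finally show ?thesis by (simp add: C_def a_def h_def)
qed

section \<open>Tilted kernels and the covariance operator\<close>

lemma partition_fn_pos:
  assumes "\<And>x y. K $ x $ y > 0"
  shows "partition_fn K g x > 0"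
  unfolding partition_fn_def using assms by (intro sum_pos) auto

lemma tilted_pos:
  assumes "\<And>x y. K $ x $ y > 0"
  shows "tilted K g x $ y > 0"
  using assms partition_fn_pos[OF assms] by (simp add: tilted_def)

lemma tilted_sum:
  assumes "\<And>x y. K $ x $ y > 0"
  shows "(\<Sum>y\<in>UNIV. tilted K g x $ y) = 1"
  using partition_fn_pos[OF assms, of g x]
  by (simp add: tilted_def sum_divide_distrib[symmetric] partition_fn_def[symmetric])

lemma marginal_pos:
  assumes "\<And>x y. K $ x $ y > 0" "\<And>x. \<mu> $ x > 0"
  shows "marginal K \<mu> g $ y > 0"
  unfolding marginal_def using assms tilted_pos[OF assms(1)] by (auto intro!: sum_pos)

lemma prob_vector_marginal:
  assumes "\<And>x y. K $ x $ y > 0" "prob_vector \<mu>"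
  shows "prob_vector (marginal K \<mu> g)"
proof -
  have "(\<Sum>y\<in>UNIV. marginal K \<mu> g $ y) = (\<Sum>x\<in>UNIV. \<Sum>y\<in>UNIV. \<mu> $ x * tilted K g x $ y)"
    unfolding marginal_def by (simp, rule sum.swap)
  also have "\<dots> = 1"
    using assms(2) by (simp add: sum_distrib_left[symmetric] tilted_sum[OF assms(1)] prob_vector_def)
  moreover have "0 \<le> marginal K \<mu> g $ y" for y
    using assms(2) tilted_pos[OF assms(1)]
    by (auto simp: marginal_def prob_vector_def less_imp_le intro!: sum_nonneg)
  ultimately show ?thesis by (simp add: prob_vector_def)
qed

lemma matrix_vector_mult_sum_left:
  fixes A :: "'b \<Rightarrow> real^'n^'m"
  shows "(\<Sum>x\<in>S. A x) *v d = (\<Sum>x\<in>S. A x *v d)"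
  by (induction S rule: infinite_finite_induct) (auto simp: matrix_vector_mult_add_rdistrib)

lemma cov_operator_apply:
  "(cov_operator K \<mu> g *v d) $ y =
     (\<Sum>x\<in>UNIV. \<mu> $ x * (tilted K g x $ y * (d $ y - tilted K g x \<bullet> d)))"
proof -
  have diag: "(diag p *v d) $ y = p $ y * d $ y" for p :: "real^'a"
    by (simp add: matrix_vector_mult_def diag_def mult_delta_left)
  have rank_one: "(((columnvector p :: real^1^'a) ** (rowvector p :: real^'a^1)) *v d) $ y = p $ y * (p \<bullet> d)"
    for p :: "real^'a"
    by (simp add: matrix_vector_mult_def matrix_matrix_mult_def columnvector_def rowvector_def
        inner_vec_def sum_distrib_left mult_ac)
  have "((\<mu> $ x *\<^sub>R (diag p - (columnvector p :: real^1^'a) ** (rowvector p :: real^'a^1))) *v d) $ y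
      = \<mu> $ x * (p $ y * (d $ y - p \<bullet> d))" for x and p :: "real^'a"
    by (simp add: scaleR_matrix_vector_assoc[symmetric] matrix_vector_mult_diff_rdistrib diag rank_one
        right_diff_distrib)
  then show ?thesis
    by (simp add: cov_operator_def matrix_vector_mult_sum_left)
qed

lemma cov_operator_mass_zero:
  assumes "\<And>x y. K $ x $ y > 0"
  shows "(\<Sum>y\<in>UNIV. (cov_operator K \<mu> g *v d) $ y) = 0"
proof -
  have "(\<Sum>y\<in>UNIV. tilted K g x $ y * (d $ y - tilted K g x \<bullet> d)) = 0" for x
  proof -
    have "(\<Sum>y\<in>UNIV. tilted K g x $ y * (d $ y - tilted K g x \<bullet> d)) =
        tilted K g x \<bullet> d - (\<Sum>y\<in>UNIV. tilted K g x $ y) * (tilted K g x \<bullet> d)"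
      unfolding sum_distrib_right right_diff_distrib sum_subtractf
      by (simp add: inner_vec_def[of "tilted K g x" d])
    then show ?thesis by (simp add: tilted_sum[OF assms])
  qed
  then show ?thesis
    unfolding cov_operator_apply by (subst sum.swap) (simp add: sum_distrib_left[symmetric])
qed

text \<open>
  One factor \<open>f(y)\<close> can be centred at no cost, because the other factor already has mean zero under
  \<open>p\<^sub>g(\<cdot>|x)\<close>; this exhibits the quadratic form as an average of variances.
\<close>

lemma cov_operator_quadratic_form:
  assumes "\<And>x y. K $ x $ y > 0"
  shows "f \<bullet> (cov_operator K \<mu> g *v f) =
    (\<Sum>x\<in>UNIV. \<mu> $ x * (\<Sum>y\<in>UNIV. tilted K g x $ y * (f $ y - tilted K g x \<bullet> f)\<^sup>2))"
proof -
  have variance: "(\<Sum>y\<in>UNIV. f $ y * (p $ y * (f $ y - p \<bullet> f))) = (\<Sum>y\<in>UNIV. p $ y * (f $ y - p \<bullet> f)\<^sup>2)"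
    if "(\<Sum>y\<in>UNIV. p $ y) = 1" for p :: "real^'a"
  proof -
    have "(\<Sum>y\<in>UNIV. f $ y * (p $ y * (f $ y - p \<bullet> f))) - (\<Sum>y\<in>UNIV. p $ y * (f $ y - p \<bullet> f)\<^sup>2)
      = (p \<bullet> f) * (\<Sum>y\<in>UNIV. p $ y * f $ y - p $ y * (p \<bullet> f))"
      by (simp add: sum_subtractf[symmetric] sum_distrib_left power2_eq_square algebra_simps)
    also have "\<dots> = 0"
      using that by (simp add: sum_subtractf sum_distrib_right[symmetric] inner_vec_def)
    finally show ?thesis by simp
  qed
  have "f \<bullet> (cov_operator K \<mu> g *v f) =
    (\<Sum>x\<in>UNIV. \<Sum>y\<in>UNIV. \<mu> $ x * (f $ y * (tilted K g x $ y * (f $ y - tilted K g x \<bullet> f))))"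
    unfolding inner_vec_def[of f] cov_operator_apply
    by (subst sum.swap) (simp add: sum_distrib_left mult_ac)
  then show ?thesis
    by (simp add: sum_distrib_left[symmetric] variance tilted_sum[OF assms])
qed

text \<open>
  Replacing the weights \<open>p\<close> by the smaller weights \<open>\<delta> \<nu>\<close> decreases the second moment about any
  point, and the second moment under \<open>\<nu>\<close> is smallest about the mean, which is \<open>0\<close>.
\<close>

lemma cov_operator_coercive:
  assumes K: "\<And>x y. K $ x $ y > 0" and \<mu>: "prob_vector \<mu>" and \<nu>: "prob_vector \<nu>"
    and \<delta>: "0 \<le> \<delta>" "\<And>x y. \<delta> \<le> tilted K g x $ y" and f: "expect \<nu> f = 0"
  shows "\<delta> * (L2_norm \<nu> f)\<^sup>2 \<le> f \<bullet> (cov_operator K \<mu> g *v f)"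
proof -
  have moment: "(L2_norm \<nu> f)\<^sup>2 \<le> (\<Sum>y\<in>UNIV. \<nu> $ y * (f $ y - c)\<^sup>2)" for c
  proof -
    have "(\<Sum>y\<in>UNIV. \<nu> $ y * (f $ y - c)\<^sup>2) =
        (\<Sum>y\<in>UNIV. \<nu> $ y * (f $ y)\<^sup>2) - 2 * c * expect \<nu> f + c\<^sup>2 * (\<Sum>y\<in>UNIV. \<nu> $ y)"
      by (simp add: expect_def sum_distrib_left sum_subtractf[symmetric] sum.distrib[symmetric]
          power2_eq_square algebra_simps)
    then show ?thesis using f \<nu> by (simp add: L2_norm_power2[OF \<nu>] prob_vector_def)
  qed
  have "\<delta> * (L2_norm \<nu> f)\<^sup>2 \<le> (\<Sum>y\<in>UNIV. tilted K g x $ y * (f $ y - tilted K g x \<bullet> f)\<^sup>2)" for x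
  proof -
    have weight: "\<delta> * \<nu> $ y \<le> tilted K g x $ y" for y
      using mult_left_mono[OF prob_vector_le_1[OF \<nu>] \<delta>(1)] \<delta>(2)[of x y]
      by (auto intro: order_trans)
    have "\<delta> * (L2_norm \<nu> f)\<^sup>2 \<le> \<delta> * (\<Sum>y\<in>UNIV. \<nu> $ y * (f $ y - tilted K g x \<bullet> f)\<^sup>2)"
      using moment \<delta>(1) by (intro mult_left_mono) auto
    also have "\<dots> = (\<Sum>y\<in>UNIV. \<delta> * \<nu> $ y * (f $ y - tilted K g x \<bullet> f)\<^sup>2)"
      by (simp add: sum_distrib_left mult_ac)
    also have "\<dots> \<le> (\<Sum>y\<in>UNIV. tilted K g x $ y * (f $ y - tilted K g x \<bullet> f)\<^sup>2)"
      using weight by (intro sum_mono mult_right_mono) auto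
    finally show ?thesis .
  qed
  then have "(\<Sum>x\<in>UNIV. \<mu> $ x * (\<delta> * (L2_norm \<nu> f)\<^sup>2)) \<le> f \<bullet> (cov_operator K \<mu> g *v f)"
    unfolding cov_operator_quadratic_form[OF K] using \<mu>
    by (intro sum_mono mult_left_mono) (auto simp: prob_vector_def)
  then show ?thesis using \<mu> by (simp add: sum_distrib_right[symmetric] prob_vector_def)
qed

section \<open>Uniform bounds on sublevel sets of the dual functional\<close>

text \<open>
  Keeping a single term of \<open>Z\<^sub>g(x)\<close> gives \<open>ln Z\<^sub>g(x) \<ge> ln k + g(z)\<close> for every \<open>z\<close>, so \<open>\<J>\<close> bounds
  \<open>g\<close> from above.  If \<open>M \<ge> 0\<close>, a function with \<open>\<nu>\<close>-mean zero that is at most \<open>M\<close> satisfies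
  \<open>\<nu>(y) g(y) = - \<Sum>\<^sub>z\<^sub>\<noteq>\<^sub>y \<nu>(z) g(z) \<ge> - M\<close>, which bounds it from below.
\<close>

lemma sublevel_bounded:
  fixes K :: "real^'n^'n"
  assumes K: "\<And>x y. K $ x $ y > 0" and \<mu>: "prob_vector \<mu>" and \<nu>: "prob_vector \<nu>"
    and \<nu>_pos: "\<And>y. \<nu> $ y > 0"
  obtains M where "\<And>g y. g \<in> sublevel K \<mu> \<nu> g0 \<Longrightarrow> \<bar>g $ y\<bar> \<le> M"
proof -
  define k where "k = Min (range (\<lambda>(x, y). K $ x $ y))"
  have k_le: "k \<le> K $ x $ y" for x y
    unfolding k_def by (rule Min_le) (auto intro: range_eqI[of _ _ "(x, y)"])
  have k_pos: "k > 0"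
    unfolding k_def using K by (subst Min_gr_iff) auto
  define M where "M = max 0 (dual_functional K \<mu> \<nu> g0 - ln k)"
  define C where "C = (\<Sum>y\<in>UNIV. 1 / \<nu> $ y)"
  show thesis
  proof (rule that[of "M + M * C"])
    fix g y assume g: "g \<in> sublevel K \<mu> \<nu> g0"
    then have mean: "expect \<nu> g = 0"
      and level: "dual_functional K \<mu> \<nu> g \<le> dual_functional K \<mu> \<nu> g0"
      by (auto simp: sublevel_def gauge_space_def)
    have M0: "0 \<le> M" by (simp add: M_def)
    have upper: "g $ z \<le> M" for z
    proof -
      have "ln k + g $ z \<le> ln (partition_fn K g x)" for x
      proof -
        have "k * exp (g $ z) \<le> K $ x $ z * exp (g $ z)"
          using k_le by (intro mult_right_mono) auto
        also have "\<dots> \<le> partition_fn K g x"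
          unfolding partition_fn_def using K
          by (intro member_le_sum[where f = "\<lambda>z. K $ x $ z * exp (g $ z)"]) (auto simp: less_imp_le)
        finally have "ln (k * exp (g $ z)) \<le> ln (partition_fn K g x)"
          using k_pos by (intro ln_mono) auto
        then show ?thesis using k_pos by (simp add: ln_mult)
      qed
      then have "(\<Sum>x\<in>UNIV. \<mu> $ x * (ln k + g $ z)) \<le> (\<Sum>x\<in>UNIV. \<mu> $ x * ln (partition_fn K g x))"
        using \<mu> by (intro sum_mono mult_left_mono) (auto simp: prob_vector_def)
      then have "ln k + g $ z \<le> dual_functional K \<mu> \<nu> g"
        using \<mu> mean by (simp add: sum_distrib_right[symmetric] prob_vector_def dual_functional_def)
      then show ?thesis using level by (simp add: M_def)
    qed
    have "0 = \<nu> $ y * g $ y + (\<Sum>z\<in>UNIV - {y}. \<nu> $ z * g $ z)"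
      using mean by (simp add: expect_def sum.remove[of UNIV y])
    also have "(\<Sum>z\<in>UNIV - {y}. \<nu> $ z * g $ z) \<le> (\<Sum>z\<in>UNIV - {y}. \<nu> $ z * M)"
      using upper \<nu>_pos by (intro sum_mono mult_left_mono) (auto simp: less_imp_le)
    also have "\<dots> \<le> (\<Sum>z\<in>UNIV. \<nu> $ z * M)"
      using M0 \<nu>_pos by (intro sum_mono2) (auto simp: less_imp_le)
    also have "\<dots> = M" using \<nu> by (simp add: sum_distrib_right[symmetric] prob_vector_def)
    finally have "- M \<le> g $ y * \<nu> $ y" by (simp add: mult.commute)
    then have "- (M * (1 / \<nu> $ y)) \<le> g $ y" using \<nu>_pos[of y] by (simp add: field_simps)
    moreover have "1 / \<nu> $ y \<le> C"
      unfolding C_def using \<nu>_pos by (intro member_le_sum) (auto simp: less_imp_le)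
    then have "M * (1 / \<nu> $ y) \<le> M * C" using M0 by (intro mult_left_mono)
    moreover have "0 \<le> M * C"
      unfolding C_def using M0 \<nu>_pos by (intro mult_nonneg_nonneg sum_nonneg) (auto simp: less_imp_le)
    ultimately show "\<bar>g $ y\<bar> \<le> M + M * C" using upper[of y] M0 by linarith
  qed
qed

lemma tilted_lower_bound_on_sublevel:
  fixes K :: "real^'n^'n"
  assumes K: "\<And>x y. K $ x $ y > 0" and \<mu>: "prob_vector \<mu>" and \<nu>: "prob_vector \<nu>"
    and \<nu>_pos: "\<And>y. \<nu> $ y > 0"
  obtains \<delta> where "\<delta> > 0" "\<And>g x y. g \<in> sublevel K \<mu> \<nu> g0 \<Longrightarrow> \<delta> \<le> tilted K g x $ y"
proof -
  obtain M where M: "\<And>g y. g \<in> sublevel K \<mu> \<nu> g0 \<Longrightarrow> \<bar>g $ y\<bar> \<le> M"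
    using sublevel_bounded[OF assms] by blast
  \<comment> \<open>Changing \<open>g\<close> to \<open>0\<close> changes numerator and denominator of the tilted kernel by factors within
    \<open>[exp (- M), exp M]\<close>.\<close>
  define \<delta> where "\<delta> = exp (- 2 * M) * Min (range (\<lambda>(x, y). tilted K 0 x $ y))"
  show thesis
  proof (rule that[of \<delta>])
    show "\<delta> > 0"
      unfolding \<delta>_def using tilted_pos[OF K] by (auto simp: Min_gr_iff)
    fix g x y assume g: "g \<in> sublevel K \<mu> \<nu> g0"
    have bounds: "g $ z \<le> M" "- M \<le> g $ z" for z
      using M[OF g, of z] by auto
    have Z: "partition_fn K g x \<le> exp M * partition_fn K 0 x"
      unfolding partition_fn_def sum_distrib_left
      using K bounds by (intro sum_mono) (auto simp: mult_ac)
    have "\<delta> \<le> exp (- 2 * M) * tilted K 0 x $ y"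
      unfolding \<delta>_def
      by (intro mult_left_mono Min_le) (auto intro: range_eqI[of _ _ "(x, y)"])
    also have "\<dots> = K $ x $ y * exp (- M) / (exp M * partition_fn K 0 x)"
      by (simp add: tilted_def field_simps exp_minus exp_add[symmetric])
    also have "\<dots> \<le> K $ x $ y * exp (g $ y) / (exp M * partition_fn K 0 x)"
      using K[of x y] bounds partition_fn_pos[OF K, of 0 x]
      by (intro divide_right_mono mult_left_mono) (auto simp: less_imp_le)
    also have "\<dots> \<le> K $ x $ y * exp (g $ y) / partition_fn K g x"
      using K[of x y] Z partition_fn_pos[OF K, of g x] partition_fn_pos[OF K, of 0 x]
      by (intro divide_left_mono) (auto simp: less_imp_le)
    also have "\<dots> = tilted K g x $ y" by (simp add: tilted_def)
    finally show "\<delta> \<le> tilted K g x $ y" .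
  qed
qed

lemma admissible_constants_exist:
  assumes K: "\<And>x y. K $ x $ y > 0" and \<mu>: "prob_vector \<mu>" and \<nu>: "prob_vector \<nu>"
    and \<mu>_pos: "\<And>x. \<mu> $ x > 0" and \<nu>_pos: "\<And>y. \<nu> $ y > 0"
  shows "\<exists>lam C. admissible_constants K \<mu> \<nu> g0 lam C"
proof -
  obtain \<delta> where \<delta>: "\<delta> > 0" "\<And>g x y. g \<in> sublevel K \<mu> \<nu> g0 \<Longrightarrow> \<delta> \<le> tilted K g x $ y"
    using tilted_lower_bound_on_sublevel[OF K \<mu> \<nu> \<nu>_pos] by blast
  have "(\<Sum>y\<in>UNIV. 1 / \<nu> $ y) > 0" using \<nu>_pos by (intro sum_pos) auto
  moreover have "KL (marginal K \<mu> g) \<nu> \<le> (\<Sum>y\<in>UNIV. 1 / \<nu> $ y) * (L2_norm \<nu>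
      (log_ratio (marginal K \<mu> g) \<nu> - vec (expect \<nu> (log_ratio (marginal K \<mu> g) \<nu>))))\<^sup>2" for g
    by (intro KL_le_log_ratio_fluctuation prob_vector_marginal marginal_pos assms)
  moreover have "\<delta> * (L2_norm \<nu> f)\<^sup>2 \<le> f \<bullet> (cov_operator K \<mu> g *v f)"
    if "g \<in> sublevel K \<mu> \<nu> g0" "expect \<nu> f = 0" for f g
    using \<delta> that by (intro cov_operator_coercive K \<mu> \<nu>) (auto simp: less_imp_le)
  ultimately have "admissible_constants K \<mu> \<nu> g0 \<delta> (\<Sum>y\<in>UNIV. 1 / \<nu> $ y)"
    using \<delta>(1) by (simp add: admissible_constants_def)
  then show ?thesis by blast
qed

section \<open>Derivatives along a curve of potentials\<close>

lemma has_real_derivative_component: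
  assumes "(g has_vector_derivative d) F"
  shows "((\<lambda>s. g s $ y) has_real_derivative d $ y) F"
  using bounded_linear.has_vector_derivative[OF bounded_linear_vec_nth assms]
  by (simp add: has_real_derivative_iff_has_vector_derivative)

lemma partition_fn_derivative:
  assumes K: "\<And>x y. K $ x $ y > 0" and g: "(g has_vector_derivative d) (at t within T)"
  shows "((\<lambda>s. partition_fn K (g s) x) has_real_derivative
    partition_fn K (g t) x * (tilted K (g t) x \<bullet> d)) (at t within T)"
proof -
  have "((\<lambda>s. partition_fn K (g s) x) has_real_derivative
      (\<Sum>z\<in>UNIV. K $ x $ z * (exp (g t $ z) * d $ z))) (at t within T)"
    unfolding partition_fn_def
    by (intro DERIV_sum DERIV_cmult DERIV_chain2[OF DERIV_exp] has_real_derivative_component[OF g])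
  also have "(\<Sum>z\<in>UNIV. K $ x $ z * (exp (g t $ z) * d $ z)) =
      partition_fn K (g t) x * (tilted K (g t) x \<bullet> d)"
    using partition_fn_pos[OF K, of "g t" x]
    by (simp add: inner_vec_def tilted_def sum_distrib_left mult_ac)
  finally show ?thesis .
qed

lemma log_partition_fn_derivative:
  assumes K: "\<And>x y. K $ x $ y > 0" and g: "(g has_vector_derivative d) (at t within T)"
  shows "((\<lambda>s. ln (partition_fn K (g s) x)) has_real_derivative tilted K (g t) x \<bullet> d) (at t within T)"
  using DERIV_chain2[OF DERIV_ln partition_fn_derivative[OF assms]] partition_fn_pos[OF K, of "g t" x]
  by (simp add: field_simps)

lemma tilted_derivative:
  assumes K: "\<And>x y. K $ x $ y > 0" and g: "(g has_vector_derivative d) (at t within T)"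
  shows "((\<lambda>s. tilted K (g s) x $ y) has_real_derivative
    tilted K (g t) x $ y * (d $ y - tilted K (g t) x \<bullet> d)) (at t within T)"
proof -
  have Z: "partition_fn K (g s) x > 0" for s by (rule partition_fn_pos[OF K])
  have log_form: "tilted K (g s) x $ y = K $ x $ y * exp (g s $ y - ln (partition_fn K (g s) x))" for s
    using Z[of s] by (simp add: tilted_def exp_diff)
  have "((\<lambda>s. K $ x $ y * exp (g s $ y - ln (partition_fn K (g s) x))) has_real_derivative
      K $ x $ y * (exp (g t $ y - ln (partition_fn K (g t) x)) * (d $ y - tilted K (g t) x \<bullet> d)))
      (at t within T)"
    by (intro DERIV_cmult DERIV_chain2[OF DERIV_exp] DERIV_diff has_real_derivative_component[OF g]
        log_partition_fn_derivative[OF assms])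
  then show ?thesis
    by (simp add: log_form mult.assoc)
qed

lemma marginal_derivative:
  assumes K: "\<And>x y. K $ x $ y > 0" and g: "(g has_vector_derivative d) (at t within T)"
  shows "((\<lambda>s. marginal K \<mu> (g s) $ y) has_real_derivative
    (cov_operator K \<mu> (g t) *v d) $ y) (at t within T)"
  unfolding cov_operator_apply marginal_def vec_lambda_beta
  by (intro DERIV_sum DERIV_cmult tilted_derivative[OF assms])

lemma dual_functional_derivative:
  assumes K: "\<And>x y. K $ x $ y > 0" and g: "(g has_vector_derivative d) (at t within T)"
  shows "((\<lambda>s. dual_functional K \<mu> \<nu> (g s)) has_real_derivative
    expect (marginal K \<mu> (g t)) d - expect \<nu> d) (at t within T)"
proof -
  have "((\<lambda>s. dual_functional K \<mu> \<nu> (g s)) has_real_derivative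
    (\<Sum>x\<in>UNIV. \<mu> $ x * (tilted K (g t) x \<bullet> d)) - (\<Sum>y\<in>UNIV. \<nu> $ y * d $ y)) (at t within T)"
    unfolding dual_functional_def expect_def
    by (intro DERIV_diff DERIV_sum DERIV_cmult log_partition_fn_derivative[OF assms]
        has_real_derivative_component[OF g])
  also have "(\<Sum>x\<in>UNIV. \<mu> $ x * (tilted K (g t) x \<bullet> d)) = expect (marginal K \<mu> (g t)) d"
    unfolding expect_def marginal_def inner_vec_def sum_distrib_left
    by (subst sum.swap) (simp add: sum_distrib_left mult_ac)
  finally show ?thesis by (simp add: expect_def)
qed

text \<open>
  Differentiating the logarithm contributes the derivative of the total mass of the marginal,
  which vanishes.
\<close>

lemma KL_marginal_derivative:
  assumes K: "\<And>x y. K $ x $ y > 0" and \<mu>_pos: "\<And>x. \<mu> $ x > 0" and \<nu>_pos: "\<And>y. \<nu> $ y > 0"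
    and g: "(g has_vector_derivative d) (at t within T)"
  shows "((\<lambda>s. KL (marginal K \<mu> (g s)) \<nu>) has_real_derivative
    (cov_operator K \<mu> (g t) *v d) \<bullet> log_ratio (marginal K \<mu> (g t)) \<nu>) (at t within T)"
proof -
  define m m' where "m s = marginal K \<mu> (g s)" and "m' = cov_operator K \<mu> (g t) *v d" for s
  have m_pos: "m s $ y > 0" for s y
    unfolding m_def by (intro marginal_pos K \<mu>_pos)
  have m': "((\<lambda>s. m s $ y) has_real_derivative m' $ y) (at t within T)" for y
    unfolding m_def m'_def by (intro marginal_derivative K g)
  have "((\<lambda>s. m s $ y * ln (m s $ y / \<nu> $ y)) has_real_derivative
      m' $ y * ln (m t $ y / \<nu> $ y) + m' $ y) (at t within T)" for y
    using m_pos[of t y] \<nu>_pos[of y]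
    by (auto intro!: derivative_eq_intros m' simp: field_simps)
  then have "((\<lambda>s. KL (m s) \<nu>) has_real_derivative
      (\<Sum>y\<in>UNIV. m' $ y * ln (m t $ y / \<nu> $ y) + m' $ y)) (at t within T)"
    unfolding KL_def by (intro DERIV_sum)
  moreover have "(\<Sum>y\<in>UNIV. m' $ y) = 0"
    unfolding m'_def by (rule cov_operator_mass_zero[OF K])
  ultimately show ?thesis
    by (simp add: sum.distrib inner_vec_def log_ratio_def m_def m'_def)
qed

section \<open>Monotonicity and decay along the flow\<close>

text \<open>Gronwall's inequality: \<open>\<phi>(s) exp (\<omega> s)\<close> is nonincreasing.\<close>

lemma exponential_decay:
  fixes \<phi> \<phi>' :: "real \<Rightarrow> real"
  assumes deriv: "\<And>s. 0 \<le> s \<Longrightarrow> (\<phi> has_real_derivative \<phi>' s) (at s within {0..})"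
    and ineq: "\<And>s. 0 \<le> s \<Longrightarrow> \<phi>' s \<le> - \<omega> * \<phi> s" and t: "0 \<le> t"
  shows "\<phi> t \<le> \<phi> 0 * exp (- \<omega> * t)"
proof -
  define E where "E s = (\<phi>' s + \<omega> * \<phi> s) * exp (\<omega> * s)" for s
  have "((\<lambda>s. \<phi> s * exp (\<omega> * s)) has_real_derivative E s) (at s within {0..t})" if "s \<in> {0..t}" for s
  proof -
    have "(\<phi> has_real_derivative \<phi>' s) (at s within {0..t})"
      using that by (intro DERIV_subset[OF deriv]) auto
    then show ?thesis unfolding E_def
      by (auto intro!: derivative_eq_intros simp: algebra_simps)
  qed
  then have "\<exists>s\<in>{0..t}. \<phi> t * exp (\<omega> * t) - \<phi> 0 * exp (\<omega> * 0) = E s * (t - 0)"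
    using t by (intro mvt_very_simple) (auto simp: has_field_derivative_def)
  then obtain s where s: "0 \<le> s" "\<phi> t * exp (\<omega> * t) - \<phi> 0 = E s * t" by auto
  moreover have "E s \<le> 0"
    unfolding E_def using ineq[OF s(1)] by (intro mult_nonpos_nonneg) auto
  ultimately have "\<phi> t * exp (\<omega> * t) \<le> \<phi> 0"
    using mult_nonpos_nonneg[OF _ t] by fastforce
  then show ?thesis by (simp add: exp_minus field_simps)
qed

lemma expect_flow_field:
  assumes "prob_vector \<nu>"
  shows "expect \<nu> (flow_field K \<mu> \<nu> g) = 0"
proof -
  define h where "h = log_ratio (marginal K \<mu> g) \<nu>"
  have "expect \<nu> (- h + vec (expect \<nu> h)) = - expect \<nu> (h - vec (expect \<nu> h))"
    by (simp add: expect_def sum_negf[symmetric] algebra_simps)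
  then show ?thesis
    by (simp add: flow_field_def h_def expect_minus_vec[OF assms])
qed

lemma flow_stays_in_sublevel:
  assumes K: "\<And>x y. K $ x $ y > 0" and \<mu>: "prob_vector \<mu>" and \<nu>: "prob_vector \<nu>"
    and \<mu>_pos: "\<And>x. \<mu> $ x > 0" and \<nu>_pos: "\<And>y. \<nu> $ y > 0"
    and g0: "g0 \<in> gauge_space \<nu>" and g: "flow_solution K \<mu> \<nu> g0 g" and t: "0 \<le> t"
  shows "g t \<in> sublevel K \<mu> \<nu> g0"
proof -
  define w where "w s = flow_field K \<mu> \<nu> (g s)" for s
  have init: "g 0 = g0" using g by (simp add: flow_solution_def)
  have g': "(g has_vector_derivative w s) (at s within {0..})" if "0 \<le> s" for s
    using g that by (auto simp: flow_solution_def w_def)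
  have mean_w: "expect \<nu> (w s) = 0" for s
    unfolding w_def by (rule expect_flow_field[OF \<nu>])
  have "((\<lambda>s. expect \<nu> (g s)) has_real_derivative 0) (at s within {0..})" if "0 \<le> s" for s
  proof -
    have "((\<lambda>s. expect \<nu> (g s)) has_real_derivative expect \<nu> (w s)) (at s within {0..})"
      unfolding expect_def
      by (intro DERIV_sum DERIV_cmult has_real_derivative_component g' that)
    then show ?thesis by (simp add: mean_w)
  qed
  then have "expect \<nu> (g t) = 0"
    using has_field_derivative_zero_constant[of "{0..}" "\<lambda>s. expect \<nu> (g s)"] t g0 init
    by (force simp: gauge_space_def)
  \<comment> \<open>With rate \<open>\<omega> = 0\<close>, the decay lemma says that a function with nonpositive derivative does not
    exceed its initial value.\<close>
  moreover have "dual_functional K \<mu> \<nu> (g t) \<le> dual_functional K \<mu> \<nu> (g 0) * exp (- 0 * t)"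
  proof (rule exponential_decay[OF _ _ t])
    fix s :: real assume s: "0 \<le> s"
    define m where "m = marginal K \<mu> (g s)"
    show "((\<lambda>s. dual_functional K \<mu> \<nu> (g s)) has_real_derivative
        expect (marginal K \<mu> (g s)) (w s) - expect \<nu> (w s)) (at s within {0..})"
      by (intro dual_functional_derivative K g' s)
    have m: "prob_vector m" "m $ y > 0" for y
      unfolding m_def by (intro prob_vector_marginal marginal_pos K \<mu> \<mu>_pos)+
    have "expect m (w s) = expect \<nu> (log_ratio m \<nu>) * (\<Sum>y\<in>UNIV. m $ y) - KL m \<nu>"
      by (simp add: w_def flow_field_def m_def[symmetric] expect_def[of m] KL_def log_ratio_def
          algebra_simps sum_subtractf sum_distrib_right)
    also have "\<dots> \<le> 0"
      using m(1) expect_log_ratio_le_KL[of m \<nu>] m(2) \<nu>_pos by (simp add: prob_vector_def)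
    finally show "expect (marginal K \<mu> (g s)) (w s) - expect \<nu> (w s) \<le> - 0 * dual_functional K \<mu> \<nu> (g s)"
      by (simp add: mean_w m_def)
  qed
  ultimately show ?thesis by (simp add: sublevel_def gauge_space_def init)
qed

text \<open>
  The log-ratio differs from minus the velocity by a constant, to which the image of the
  covariance operator is orthogonal.
\<close>

lemma entropy_dissipation:
  fixes \<mu> \<nu> g :: "real^'n"
  assumes K: "\<And>x y. K $ x $ y > 0"
  defines "w \<equiv> flow_field K \<mu> \<nu> g"
  shows "(cov_operator K \<mu> g *v w) \<bullet> log_ratio (marginal K \<mu> g) \<nu> = - (w \<bullet> (cov_operator K \<mu> g *v w))"
proof -
  define c where "c = expect \<nu> (log_ratio (marginal K \<mu> g) \<nu>)"
  have "log_ratio (marginal K \<mu> g) \<nu> = vec c - w"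
    by (simp add: w_def flow_field_def c_def)
  moreover have "(cov_operator K \<mu> g *v w) \<bullet> vec c = 0"
    using cov_operator_mass_zero[OF K, of \<mu> g w]
    by (simp add: inner_vec_def sum_distrib_right[symmetric])
  ultimately show ?thesis by (simp add: inner_diff_left inner_diff_right inner_commute)
qed

lemma KL_decay_along_flow:
  assumes K: "\<And>x y. K $ x $ y > 0" and \<mu>: "prob_vector \<mu>" and \<nu>: "prob_vector \<nu>"
    and \<mu>_pos: "\<And>x. \<mu> $ x > 0" and \<nu>_pos: "\<And>y. \<nu> $ y > 0"
    and g0: "g0 \<in> gauge_space \<nu>" and adm: "admissible_constants K \<mu> \<nu> g0 lam C"
    and g: "flow_solution K \<mu> \<nu> g0 g" and t: "0 \<le> t"
  shows "KL (marginal K \<mu> (g t)) \<nu> \<le> KL (marginal K \<mu> (g 0)) \<nu> * exp (- (lam / C) * t)"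
proof (rule exponential_decay[OF _ _ t])
  fix s :: real assume s: "0 \<le> s"
  define w h where "w = flow_field K \<mu> \<nu> (g s)" and "h = log_ratio (marginal K \<mu> (g s)) \<nu>"
  have pos: "lam > 0" "C > 0" using adm by (auto simp: admissible_constants_def)
  have "(g has_vector_derivative w) (at s within {0..})"
    using g s by (auto simp: flow_solution_def w_def)
  from KL_marginal_derivative[OF K \<mu>_pos \<nu>_pos this]
  show "((\<lambda>s. KL (marginal K \<mu> (g s)) \<nu>) has_real_derivative
      - (flow_field K \<mu> \<nu> (g s) \<bullet> (cov_operator K \<mu> (g s) *v flow_field K \<mu> \<nu> (g s)))) (at s within {0..})"
    by (simp add: entropy_dissipation[OF K] w_def)
  have sub: "g s \<in> sublevel K \<mu> \<nu> g0"
    by (rule flow_stays_in_sublevel[OF K \<mu> \<nu> \<mu>_pos \<nu>_pos g0 g s])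
  have "w = - (h - vec (expect \<nu> h))" by (simp add: w_def h_def flow_field_def)
  then have norm_w: "(L2_norm \<nu> (h - vec (expect \<nu> h)))\<^sup>2 = (L2_norm \<nu> w)\<^sup>2"
    by (simp add: L2_norm_power2[OF \<nu>] power2_commute)
  have "expect \<nu> w = 0" unfolding w_def by (rule expect_flow_field[OF \<nu>])
  then have dissipation: "lam * (L2_norm \<nu> w)\<^sup>2 \<le> w \<bullet> (cov_operator K \<mu> (g s) *v w)"
    and "KL (marginal K \<mu> (g s)) \<nu> \<le> C * (L2_norm \<nu> w)\<^sup>2"
    using adm sub norm_w by (auto simp: admissible_constants_def h_def)
  from mult_left_mono[OF this(2), of "lam / C"]
  have "lam / C * KL (marginal K \<mu> (g s)) \<nu> \<le> lam * (L2_norm \<nu> w)\<^sup>2"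
    using pos by simp
  with dissipation
  show "- (flow_field K \<mu> \<nu> (g s) \<bullet> (cov_operator K \<mu> (g s) *v flow_field K \<mu> \<nu> (g s)))
      \<le> - (lam / C) * KL (marginal K \<mu> (g s)) \<nu>"
    by (simp add: w_def)
qed

theorem theorem5p3:
  fixes Q K :: "real^'n^'n" and \<mu> \<nu> g0 :: "real^'n"
  assumes "generator Q" and "K = matexp Q"
    and "prob_vector \<mu>" and "prob_vector \<nu>"
    and "\<And>x y. K $ x $ y > 0" and "\<And>x. \<mu> $ x > 0" and "\<And>y. \<nu> $ y > 0"
    and "g0 \<in> gauge_space \<nu>"
  shows "(\<exists>lam C. admissible_constants K \<mu> \<nu> g0 lam C) \<and>
    (\<forall>lam C. admissible_constants K \<mu> \<nu> g0 lam C \<longrightarrow>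
      (\<forall>g. flow_solution K \<mu> \<nu> g0 g \<longrightarrow>
        (\<forall>t\<ge>0. KL (marginal K \<mu> (g t)) \<nu>
                \<le> KL (marginal K \<mu> (g 0)) \<nu> * exp (- (lam / C) * t))))"
  using admissible_constants_exist[OF assms(5,3,4,6,7)]
    KL_decay_along_flow[OF assms(5,3,4,6,7,8)]
  by blast

end
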